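(* Let $\phi:\mathbb{R}^n\to\mathbb{R}$ be continuously differentiable (not necessarily convex), let $A\in\mathbb{R}^{m\times n}$ have full row rank, let $b\in\mathbb{R}^m$, and suppose $\{x\in\mathbb{R}^n_+ : Ax=b\}\neq\emptyset$. Let $\mathcal{P}_{A,b}=\{y\in\mathbb{R}^n : A(y\circ y)=b\}$ and $f(y)=\phi(y\circ y)$. If $y\in\mathcal{P}_{A,b}$ is a second-order stationary point of $\min\{f(y): y\in\mathcal{P}_{A,b}\}$, then $x=y\circ y$ is a first-order stationary point of $\min\{\phi(x): Ax=b,\ x\in\mathbb{R}^n_+\}$.
   Context: $\circ$ denotes the entrywise (Hadamard) product. $\nabla^2 f$ denotes the Hessian of $f$. First-order stationary point of $\min\{\phi(x): Ax=b,\ x\in\mathbb{R}^n_+\}$: a point $x\in\mathbb{R}^n$ for which there exists $\lambda\in\mathbb{R}^m$ such that $Ax=b$, $x\in\mathbb{R}^n_+$, $\nabla\phi(x)-A^\top\lambda\in\mathbb{R}^n_+$ and $(\nabla\phi(x)-A^\top\lambda)\circ x=0$. For a closed set $S\subset\mathbb{R}^n$, $x\in S$, $h\in\mathbb{R}^n$: the contingent tangent cone is $\mathcal{T}_S(x)=\{h : \exists\, t_k\downarrow 0,\ \mathrm{dist}(x+t_kh,S)=o(t_k)\}$, and the outer second-order tangent set is $\mathcal{T}^{2}_S(x,h)=\{w : \exists\, t_k\downarrow 0,\ \mathrm{dist}(x+t_kh+t_k^2w/2,S)=o(t_k^2)\}$. Second-order stationary point of $\min\{f(y): y\in\mathcal{P}_{A,b}\}$: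 a point $y\in\mathcal{P}_{A,b}$ such that $\nabla f(y)^\top h\ge 0$ for any $h\in\mathcal{T}_{\mathcal{P}_{A,b}}(y)$ (first-order stationarity), and $\nabla f(y)^\top w+h^\top\nabla^2f(y)h\ge0$ for any $h\in\mathcal{T}_{\mathcal{P}_{A,b}}(y)$ satisfying $\nabla f(y)^\top h=0$ and any $w\in\mathcal{T}^2_{\mathcal{P}_{A,b}}(y,h)$. *)

theory Defs
  imports "HOL-Analysis.Analysis" "HOL-Library.Landau_Symbols"
begin

text \<open>
  On \<^typ>\<open>real^'n\<close> the library operations \<open>*\<close> and \<open>\<le>\<close> are componentwise: \<open>x * y\<close> is the
  Hadamard product and \<open>0 \<le> x\<close> says that \<open>x\<close> lies in the nonnegative orthant.
\<close>

definition gradient :: "('a::euclidean_space \<Rightarrow> real) \<Rightarrow> 'a \<Rightarrow> 'a" where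
  "gradient f x = (THE D. GDERIV f x :> D)"

lemma gradient_eqI:
  assumes "GDERIV f x :> D"
  shows "gradient f x = D"
  unfolding gradient_def
proof (rule the_equality)
  fix E assume "GDERIV f x :> E"
  with assms have "(\<lambda>h. h \<bullet> E) = (\<lambda>h. h \<bullet> D)"
    unfolding gderiv_def by (intro has_derivative_unique[of f _ x])
  then show "E = D"
    by (simp add: fun_eq_iff vector_eq_ldot)
qed (fact assms)

lemma differentiable_GDERIV_gradient:
  assumes "f differentiable (at x)"
  shows "GDERIV f x :> gradient f x"
proof -
  from assms obtain f' where f': "(f has_derivative f') (at x)"
    unfolding differentiable_def by blast
  then have "linear f'"
    by (rule has_derivative_linear)
  then have "f' = (\<lambda>h. h \<bullet> adjoint f' 1)"
    using adjoint_works[of f' _ 1] by (intro ext) simp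
  with f' have "GDERIV f x :> adjoint f' 1"
    unfolding gderiv_def by simp
  with gradient_eqI[OF this] show ?thesis
    by simp
qed

definition continuously_differentiable :: "('a::euclidean_space \<Rightarrow> real) \<Rightarrow> bool" where
  "continuously_differentiable f \<longleftrightarrow>
     (\<forall>x. f differentiable (at x)) \<and> continuous_on UNIV (gradient f)"

text \<open>
  \<open>H\<close> is the matrix of second-order partial derivatives of \<open>f\<close> at \<open>y\<close>, all of which are required
  to exist. This holds in particular if \<open>f\<close> is twice Frechet differentiable at \<open>y\<close>.
\<close>

definition has_hessian :: "(real^'n \<Rightarrow> real) \<Rightarrow> real^'n^'n \<Rightarrow> real^'n \<Rightarrow> bool" where
  "has_hessian f H y \<longleftrightarrow>
     (\<forall>\<^sub>F z in nhds y. f differentiable (at z)) \<and>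
     (\<forall>i j. ((\<lambda>t. gradient f (y + t *\<^sub>R axis j 1) $ i) has_real_derivative H $ i $ j) (at 0))"

definition contingent_cone :: "'a::real_normed_vector set \<Rightarrow> 'a \<Rightarrow> 'a set" where
  "contingent_cone S x =
     {h. \<exists>t :: nat \<Rightarrow> real. (\<forall>k. 0 < t k) \<and> t \<longlonglongrightarrow> 0 \<and>
           (\<lambda>k. infdist (x + t k *\<^sub>R h) S) \<in> o(t)}"

definition outer_second_order_tangent_set ::
    "'a::real_normed_vector set \<Rightarrow> 'a \<Rightarrow> 'a \<Rightarrow> 'a set" where
  "outer_second_order_tangent_set S x h =
     {w. \<exists>t :: nat \<Rightarrow> real. (\<forall>k. 0 < t k) \<and> t \<longlonglongrightarrow> 0 \<and>
           (\<lambda>k. infdist (x + t k *\<^sub>R h + ((t k)\<^sup>2 / 2) *\<^sub>R w) S) \<in> o(\<lambda>k. (t k)\<^sup>2)}"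

definition first_order_stationary ::
    "(real^'n \<Rightarrow> real) \<Rightarrow> real^'n^'m \<Rightarrow> real^'m \<Rightarrow> real^'n \<Rightarrow> bool" where
  "first_order_stationary \<phi> A b x \<longleftrightarrow>
     \<phi> differentiable (at x) \<and>
     (\<exists>lam :: real^'m.
        A *v x = b \<and> 0 \<le> x \<and>
        0 \<le> gradient \<phi> x - transpose A *v lam \<and>
        (gradient \<phi> x - transpose A *v lam) * x = 0)"

text \<open>
  Being a second-order stationary point presupposes that the Hessian of the objective exists at
  that point; this is the existential quantifier over \<open>H\<close>, which is unique.
\<close>

definition second_order_stationary ::
    "(real^'n \<Rightarrow> real) \<Rightarrow> (real^'n) set \<Rightarrow> real^'n \<Rightarrow> bool" where
  "second_order_stationary f S y \<longleftrightarrow>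
     y \<in> S \<and>
     (\<forall>h \<in> contingent_cone S y. 0 \<le> gradient f y \<bullet> h) \<and>
     (\<exists>H. has_hessian f H y \<and>
        (\<forall>h \<in> contingent_cone S y. gradient f y \<bullet> h = 0 \<longrightarrow>
           (\<forall>w \<in> outer_second_order_tangent_set S y h.
              0 \<le> gradient f y \<bullet> w + h \<bullet> (H *v h))))"

definition hadamard_variety :: "real^'n^'m \<Rightarrow> real^'m \<Rightarrow> (real^'n) set" where
  "hadamard_variety A b = {y. A *v (y * y) = b}"

end

(* If A d = 0 and d is nonnegative off the support of y, then sqrt (y * y + t^2 d), with signs chosen
   along y, is an arc in the variety. Its expansion y + t h + (t^2/2) w has h = sqrt d off the support
   of y and w = d / y on it, so grad f . h = 0 while grad f . w + h . H h = 2 (grad phi . d).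
   Second-order stationarity therefore says that grad phi is nonnegative on the cone of all such d,
   and Farkas' lemma provides the multiplier. *)

theory Submission
  imports Defs
begin

section \<open>Farkas' lemma for the kernel of \<open>A\<close> with sign constraints on
  coordinates\<close>

lemma farkas_coordinates:
  fixes A :: "real^'n^'m" and g :: "real^'n" and J :: "'n set"
  assumes nonneg: "\<And>d. A *v d = 0 \<Longrightarrow> (\<forall>i\<in>J. 0 \<le> d $ i) \<Longrightarrow> 0 \<le> g \<bullet> d"
  obtains lam :: "real^'m"
  where "\<forall>i\<in>J. 0 \<le> (g - transpose A *v lam) $ i"
    and "\<forall>i. i \<notin> J \<longrightarrow> (g - transpose A *v lam) $ i = 0"
proof -
  \<comment> \<open>The rows of \<open>A\<close> occur with both signs because the multiplier has no
    sign restriction; the unit vectors indexed by \<open>J\<close> generate the admissible residuals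
    \<open>g - transpose A *v lam\<close>.\<close>
  define G where "G = range (\<lambda>k. transpose A *v axis k 1) \<union> range (\<lambda>k. - (transpose A *v axis k 1))
    \<union> (\<lambda>i. axis i 1) ` J"
  \<comment> \<open>\<open>C\<close> consists of the vectors that admit a multiplier. It is a convex
    cone containing \<open>G\<close>, so it suffices to place \<open>g\<close> in the cone generated
    by \<open>G\<close>.\<close>
  define C where "C = {v :: real^'n. \<exists>lam. (\<forall>i\<in>J. 0 \<le> (v - transpose A *v lam) $ i) \<and>
    (\<forall>i. i \<notin> J \<longrightarrow> (v - transpose A *v lam) $ i = 0)}"
  \<comment> \<open>Finite generation makes the cone closed, so a point outside it can be strictly
    separated. The normal \<open>a\<close> of the separating hyperplane then turns out to be a
    direction that violates \<open>nonneg\<close>.\<close>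
  have "g \<in> convex_cone hull G"
  proof (rule ccontr)
    assume "g \<notin> convex_cone hull G"
    moreover have "finite G"
      unfolding G_def by simp
    ultimately obtain a c where ac: "a \<bullet> g < c" "\<forall>x\<in>convex_cone hull G. c < a \<bullet> x"
      using separating_hyperplane_closed_point[OF convex_convex_cone_hull closed_convex_cone_hull]
      by blast
    have "c < 0"
      using ac(2) convex_cone_convex_cone_hull[of G] by (auto simp: convex_cone_iff)
    have a_nonneg: "0 \<le> a \<bullet> x" if "x \<in> G" for x
    proof (rule ccontr)
      assume "\<not> 0 \<le> a \<bullet> x"
      \<comment> \<open>The factor \<open>c / (a \<bullet> x)\<close> is nonnegative and puts the
        multiple of \<open>x\<close> exactly on the level \<open>c\<close>, where the separation is
        strict.\<close>
      then have "(c / (a \<bullet> x)) *\<^sub>R x \<in> convex_cone hull G"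
        using that \<open>c < 0\<close> convex_cone_convex_cone_hull[of G]
        by (auto simp: convex_cone_iff hull_inc divide_nonpos_neg)
      with ac(2) \<open>\<not> 0 \<le> a \<bullet> x\<close> show False
        by fastforce
    qed
    have "A *v a = 0"
    proof (subst vec_eq_iff, intro allI)
      fix k
      \<comment> \<open>Both signs of each row lie in \<open>G\<close>, so \<open>a\<close> is
        orthogonal to every row.\<close>
      have "0 \<le> a \<bullet> (transpose A *v axis k 1)" "0 \<le> a \<bullet> - (transpose A *v axis k 1)"
        using a_nonneg unfolding G_def by blast+
      then have "(transpose A *v axis k 1) \<bullet> a = 0"
        by (simp add: inner_commute)
      then show "(A *v a) $ k = 0 $ k"
        by (simp add: transpose_matrix_vector dot_lmul_matrix inner_axis')
    qed
    moreover have "\<forall>i\<in>J. 0 \<le> a $ i"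
    proof
      fix i assume "i \<in> J"
      then have "0 \<le> a \<bullet> axis i 1"
        using a_nonneg unfolding G_def by blast
      then show "0 \<le> a $ i"
        by (simp add: inner_axis)
    qed
    ultimately have "0 \<le> g \<bullet> a"
      by (rule nonneg)
    with ac(1) \<open>c < 0\<close> show False
      by (simp add: inner_commute)
  qed
  also have "convex_cone hull G \<subseteq> C"
  proof (rule hull_minimal)
    show "G \<subseteq> C"
    proof
      fix v assume "v \<in> G"
      then consider k where "v = transpose A *v axis k 1" | k where "v = transpose A *v (- axis k 1)"
        | i where "i \<in> J" "v = axis i 1"
        unfolding G_def by (auto simp: linear_neg[OF matrix_vector_mul_linear])
      then show "v \<in> C"
      proof cases
        case (1 k)
        then show ?thesis
          unfolding C_def by (intro CollectI exI[of _ "axis k 1"]) simp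
      next
        case (2 k)
        then show ?thesis
          unfolding C_def by (intro CollectI exI[of _ "- axis k 1"]) simp
      next
        case (3 i)
        then show ?thesis
          unfolding C_def by (intro CollectI exI[of _ 0]) (auto simp: axis_def)
      qed
    qed
    show "convex_cone C"
      unfolding convex_cone_iff
    proof (intro conjI ballI allI impI)
      show "0 \<in> C"
        unfolding C_def by (intro CollectI exI[of _ 0]) simp
    next
      fix u v assume "u \<in> C" "v \<in> C"
      then obtain l l' where
        "\<forall>i\<in>J. 0 \<le> (u - transpose A *v l) $ i" "\<forall>i. i \<notin> J \<longrightarrow> (u - transpose A *v l) $ i = 0"
        "\<forall>i\<in>J. 0 \<le> (v - transpose A *v l') $ i" "\<forall>i. i \<notin> J \<longrightarrow> (v - transpose A *v l') $ i = 0"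
        unfolding C_def by blast
      then show "u + v \<in> C"
        unfolding C_def
        by (intro CollectI exI[of _ "l + l'"]) (force simp: matrix_vector_right_distrib)
    next
      fix v and r :: real assume "v \<in> C" "0 \<le> r"
      then obtain l where
        l: "\<forall>i\<in>J. 0 \<le> (v - transpose A *v l) $ i" "\<forall>i. i \<notin> J \<longrightarrow> (v - transpose A *v l) $ i = 0"
        unfolding C_def by blast
      have "r *\<^sub>R v - transpose A *v (r *\<^sub>R l) = r *\<^sub>R (v - transpose A *v l)"
        by (simp add: matrix_vector_mult_scaleR scaleR_diff_right)
      with l \<open>0 \<le> r\<close> show "r *\<^sub>R v \<in> C"
        unfolding C_def by (intro CollectI exI[of _ "r *\<^sub>R l"]) simp
    qed
  qed
  finally show thesis
    using that unfolding C_def by blast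
qed

section \<open>First and second derivatives of \<open>\<phi> (z * z)\<close>\<close>

lemma GDERIV_hadamard_square:
  fixes \<phi> :: "real^'n \<Rightarrow> real"
  assumes "GDERIV \<phi> (z * z) :> g"
  shows "GDERIV (\<lambda>z. \<phi> (z * z)) z :> 2 *\<^sub>R (z * g)"
proof -
  have "bilinear ((*) :: real^'n \<Rightarrow> real^'n \<Rightarrow> real^'n)"
    unfolding bilinear_def by (auto intro!: linearI simp: vec_eq_iff algebra_simps)
  then have "bounded_bilinear ((*) :: real^'n \<Rightarrow> real^'n \<Rightarrow> real^'n)"
    by (simp add: bilinear_conv_bounded_bilinear)
  then have "((\<lambda>z. z * z) has_derivative (\<lambda>h. z * h + h * z)) (at z)"
    by (rule bounded_bilinear.FDERIV) (rule has_derivative_ident)+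
  from has_derivative_compose[OF this assms[unfolded gderiv_def]]
  have "((\<lambda>z. \<phi> (z * z)) has_derivative (\<lambda>h. (z * h + h * z) \<bullet> g)) (at z)" .
  moreover have "(\<lambda>h. (z * h + h * z) \<bullet> g) = (\<lambda>h. h \<bullet> (2 *\<^sub>R (z * g)))"
    by (simp add: inner_vec_def sum_distrib_left algebra_simps fun_eq_iff sum.distrib)
  ultimately show ?thesis
    unfolding gderiv_def by simp
qed

text \<open>The \<open>i\<close>-th entry of the gradient is \<open>z $ i\<close> times a continuous
  function, and the factor \<open>z $ i\<close> vanishes at \<open>y\<close>. Its partial
  derivatives at \<open>y\<close> therefore come from that factor alone, and continuity of
  \<open>gradient \<phi>\<close> is enough even where \<open>\<phi>\<close> has no second
  derivative.\<close>

lemma hessian_hadamard_square_off_support: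
  fixes \<phi> :: "real^'n \<Rightarrow> real"
  assumes \<phi>: "continuously_differentiable \<phi>"
    and H: "has_hessian (\<lambda>z. \<phi> (z * z)) H y"
    and y: "y $ i = 0"
  shows "H $ i $ j = (if i = j then 2 * gradient \<phi> (y * y) $ i else 0)"
proof -
  let ?q = "\<lambda>t. y + t *\<^sub>R axis j 1"
  have grad: "gradient (\<lambda>z. \<phi> (z * z)) z = 2 *\<^sub>R (z * gradient \<phi> (z * z))" for z
    using \<phi> unfolding continuously_differentiable_def
    by (intro gradient_eqI GDERIV_hadamard_square differentiable_GDERIV_gradient) blast
  have D: "((\<lambda>t. 2 * (?q t $ i * gradient \<phi> (?q t * ?q t) $ i)) has_real_derivative H $ i $ j) (at 0)"
    using H unfolding has_hessian_def grad by simp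
  show ?thesis
  proof (cases "i = j")
    case True
    have "isCont (\<lambda>t. ?q t * ?q t) 0"
      unfolding isCont_def
      by (rule vec_tendstoI) (auto intro!: tendsto_eq_intros)
    moreover have "isCont (gradient \<phi>) (?q 0 * ?q 0)"
      using \<phi> by (simp add: continuously_differentiable_def continuous_on_eq_continuous_at)
    ultimately have "isCont (\<lambda>t. gradient \<phi> (?q t * ?q t)) 0"
      using isCont_o2 by blast
    then have "((\<lambda>t. 2 * gradient \<phi> (?q t * ?q t) $ i) \<longlongrightarrow> 2 * gradient \<phi> (y * y) $ i) (at 0)"
      unfolding isCont_def by (auto intro!: tendsto_intros)
    \<comment> \<open>For \<open>i = j\<close> the factor \<open>?q t $ i\<close> equals
      \<open>t\<close> and cancels the denominator of the difference quotient.\<close>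
    moreover have "((\<lambda>t. 2 * gradient \<phi> (?q t * ?q t) $ i) \<longlongrightarrow> H $ i $ j) (at 0)"
      using D[unfolded DERIV_def] y True
      by (elim Lim_transform_eventually) (auto simp: eventually_at intro!: exI[of _ 1])
    ultimately have "2 * gradient \<phi> (y * y) $ i = H $ i $ j"
      by (rule LIM_unique)
    with True show ?thesis
      by simp
  next
    case False
    \<comment> \<open>Moving along another axis keeps entry \<open>i\<close> at zero, so the
      differentiated function is constantly zero.\<close>
    with D y have "((\<lambda>_. 0) has_real_derivative H $ i $ j) (at 0)"
      by (simp add: axis_def)
    from DERIV_unique[OF this DERIV_const] False show ?thesis
      by simp
  qed
qed

section \<open>Arcs in the variety and their tangents of first and second order\<close>

lemma sqrt_second_order_expansion:
  fixes u :: real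
  assumes "- 1 \<le> u"
  shows "\<bar>sqrt (1 + u) - 1 - u / 2\<bar> \<le> u\<^sup>2 / 2"
proof -
  define s where "s = sqrt (1 + u)"
  have s: "0 \<le> s" "u = s\<^sup>2 - 1"
    using assms unfolding s_def by auto
  \<comment> \<open>The remainder is a perfect square up to sign, and
    \<open>u = (s - 1) * (s + 1)\<close> with \<open>s + 1 \<ge> 1\<close> bounds it by
    \<open>u\<^sup>2 / 2\<close>.\<close>
  have "s - 1 - u / 2 = - ((s - 1)\<^sup>2 / 2)"
    unfolding s by (simp add: power2_eq_square field_simps)
  then have "\<bar>s - 1 - u / 2\<bar> = (s - 1)\<^sup>2 / 2"
    by simp
  also have "\<dots> \<le> (s - 1)\<^sup>2 * (s + 1)\<^sup>2 / 2"
    using s(1) mult_left_mono[of 1 "(s + 1)\<^sup>2" "(s - 1)\<^sup>2"] by simp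
  also have "\<dots> = u\<^sup>2 / 2"
    unfolding s by (simp add: power2_eq_square algebra_simps)
  finally show ?thesis
    unfolding s_def .
qed

text \<open>The arc \<open>p\<close> is chosen so that
  \<open>p t * p t = y * y + t\<^sup>2 *\<^sub>R d\<close>, which keeps it in the variety because
  \<open>A *v d = 0\<close>. No cubic term appears: the square roots are expanded in powers of
  \<open>t\<^sup>2\<close>.\<close>

lemma hadamard_variety_arc:
  fixes A :: "real^'n^'m"
  assumes y: "y \<in> hadamard_variety A b"
    and d: "A *v d = 0" "\<And>i. y $ i = 0 \<Longrightarrow> 0 \<le> d $ i"
  defines "h \<equiv> \<chi> i. if y $ i = 0 then sqrt (d $ i) else 0"
    and "w \<equiv> \<chi> i. d $ i / y $ i"
  obtains K where "\<forall>\<^sub>F t in nhds 0.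
    infdist (y + t *\<^sub>R h + (t\<^sup>2 / 2) *\<^sub>R w) (hadamard_variety A b) \<le> K * t ^ 4"
proof -
  \<comment> \<open>\<open>u t i\<close> is the relative change of \<open>(y $ i)\<^sup>2\<close>.
    Where \<open>y $ i = 0\<close> it is 0 by the convention for division, so the bound
    \<open>- 1 < u t i\<close> can be asked for all \<open>i\<close> at once.\<close>
  define u where "u t i = t\<^sup>2 * (d $ i / (y $ i)\<^sup>2)" for t i
  define p where "p t = (\<chi> i. if y $ i = 0 then t * sqrt (d $ i) else y $ i * sqrt (1 + u t i))" for t
  \<comment> \<open>Each summand is \<open>\<bar>y $ i\<bar>\<close> times the remainder bound
    \<open>(u t i)\<^sup>2 / 2\<close> with \<open>t ^ 4\<close> factored out; they are added
    because the Euclidean norm is estimated by the sum of the absolute entries.\<close>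
  define K where "K = (\<Sum>i\<in>UNIV. \<bar>y $ i\<bar> * (d $ i / (y $ i)\<^sup>2)\<^sup>2 / 2)"
  have "\<forall>\<^sub>F t in nhds 0. \<forall>i. - 1 < u t i"
  proof (rule eventually_all_finite)
    fix i
    have "((\<lambda>t::real. t\<^sup>2) \<longlongrightarrow> 0) (nhds 0)"
      using tendsto_power[OF filterlim_ident, of 2 "0::real"] by simp
    then have "((\<lambda>t. u t i) \<longlongrightarrow> 0) (nhds 0)"
      unfolding u_def by (rule tendsto_mult_left_zero)
    then show "\<forall>\<^sub>F t in nhds 0. - 1 < u t i"
      by (rule order_tendstoD) simp
  qed
  then have "\<forall>\<^sub>F t in nhds 0.
    infdist (y + t *\<^sub>R h + (t\<^sup>2 / 2) *\<^sub>R w) (hadamard_variety A b) \<le> K * t ^ 4"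
  proof eventually_elim
    case (elim t)
    have sq: "p t * p t = y * y + t\<^sup>2 *\<^sub>R d"
    proof (subst vec_eq_iff, intro allI)
      fix i
      show "(p t * p t) $ i = (y * y + t\<^sup>2 *\<^sub>R d) $ i"
      proof (cases "y $ i = 0")
        case True
        then show ?thesis
          using d(2)[OF True] by (simp add: p_def power2_eq_square mult.assoc mult.left_commute)
      next
        case False
        have "(p t * p t) $ i = (y $ i)\<^sup>2 * (sqrt (1 + u t i))\<^sup>2"
          using False by (simp add: p_def power2_eq_square)
        also have "\<dots> = (y $ i)\<^sup>2 * (1 + u t i)"
          using elim[rule_format, of i] by simp
        also have "\<dots> = (y * y + t\<^sup>2 *\<^sub>R d) $ i"
          using False by (simp add: u_def field_simps power2_eq_square)
        finally show ?thesis .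
      qed
    qed
    have "p t \<in> hadamard_variety A b"
      using y d(1) unfolding hadamard_variety_def
      by (simp add: sq matrix_vector_right_distrib matrix_vector_mult_scaleR)
    moreover have "dist (y + t *\<^sub>R h + (t\<^sup>2 / 2) *\<^sub>R w) (p t) \<le> K * t ^ 4"
    proof -
      have "\<bar>(p t - (y + t *\<^sub>R h + (t\<^sup>2 / 2) *\<^sub>R w)) $ i\<bar>
          \<le> \<bar>y $ i\<bar> * (d $ i / (y $ i)\<^sup>2)\<^sup>2 / 2 * t ^ 4" for i
      proof (cases "y $ i = 0")
        \<comment> \<open>The expansion is exact here: \<open>h\<close> supplies
          \<open>t * sqrt (d $ i)\<close>, and \<open>w $ i = d $ i / 0\<close> is 0.\<close>
        case True
        then show ?thesis
          by (simp add: p_def h_def w_def)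
      next
        case False
        \<comment> \<open>The term \<open>(t\<^sup>2 / 2) * w $ i\<close> is
          \<open>y $ i * u t i / 2\<close>, the linear term of the square root; this dictates
          \<open>w $ i = d $ i / y $ i\<close>.\<close>
        have "(p t - (y + t *\<^sub>R h + (t\<^sup>2 / 2) *\<^sub>R w)) $ i
            = y $ i * (sqrt (1 + u t i) - 1 - u t i / 2)"
          using False by (simp add: p_def h_def w_def u_def power2_eq_square field_simps)
        then have "\<bar>(p t - (y + t *\<^sub>R h + (t\<^sup>2 / 2) *\<^sub>R w)) $ i\<bar>
            = \<bar>y $ i\<bar> * \<bar>sqrt (1 + u t i) - 1 - u t i / 2\<bar>"
          by (simp add: abs_mult)
        also have "\<dots> \<le> \<bar>y $ i\<bar> * ((u t i)\<^sup>2 / 2)"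
          using elim[rule_format, of i]
          by (intro mult_left_mono sqrt_second_order_expansion) auto
        also have "\<dots> = \<bar>y $ i\<bar> * (d $ i / (y $ i)\<^sup>2)\<^sup>2 / 2 * t ^ 4"
          by (simp add: u_def power2_eq_square power4_eq_xxxx)
        finally show ?thesis .
      qed
      then have "(\<Sum>i\<in>UNIV. \<bar>(p t - (y + t *\<^sub>R h + (t\<^sup>2 / 2) *\<^sub>R w)) $ i\<bar>) \<le> K * t ^ 4"
        unfolding K_def sum_distrib_right by (intro sum_mono)
      with norm_le_l1_cart[of "p t - (y + t *\<^sub>R h + (t\<^sup>2 / 2) *\<^sub>R w)"] show ?thesis
        by (simp add: dist_norm norm_minus_commute)
    qed
    ultimately show ?case
      by (rule infdist_le2)
  qed
  then show thesis
    by (rule that)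
qed

text \<open>Along \<open>t k = 1 / (k + 1)\<close> an error of order \<open>t ^ 4\<close> is
  \<open>o(t\<^sup>2)\<close>, which gives \<open>w\<close>. Dropping the \<open>w\<close> term
  changes the distance by at most a multiple of \<open>t\<^sup>2\<close>, which is
  \<open>o(t)\<close> and gives \<open>h\<close>.\<close>

lemma arc_tangents:
  fixes S :: "'a::real_normed_vector set"
  assumes arc: "\<forall>\<^sub>F t in nhds 0. infdist (y + t *\<^sub>R h + (t\<^sup>2 / 2) *\<^sub>R w) S \<le> K * t ^ 4"
  shows "h \<in> contingent_cone S y" and "w \<in> outer_second_order_tangent_set S y h"
proof -
  define t :: "nat \<Rightarrow> real" where "t k = inverse (real (Suc k))" for k
  have pos: "0 < t k" for k
    by (simp add: t_def)
  have lim: "t \<longlonglongrightarrow> 0"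
    unfolding t_def by (rule LIMSEQ_inverse_real_of_nat)
  have ev: "\<forall>\<^sub>F k in sequentially.
      infdist (y + t k *\<^sub>R h + ((t k)\<^sup>2 / 2) *\<^sub>R w) S \<le> K * t k ^ 4"
    using arc lim by (rule eventually_compose_filterlim)
  have small: "(\<lambda>k. t k ^ n) \<in> o(\<lambda>k. t k ^ m)" if "m < n" for m n
  proof (rule smalloI_tendsto)
    have "(\<lambda>k. t k ^ (n - m)) \<longlonglongrightarrow> 0"
      using tendsto_power[OF lim, of "n - m"] that by (simp add: power_0_left)
    then show "(\<lambda>k. t k ^ n / t k ^ m) \<longlonglongrightarrow> 0"
      using that pos by (subst power_diff[symmetric]) (auto simp: less_imp_neq[symmetric] less_imp_le)
    show "\<forall>\<^sub>F k in sequentially. t k ^ m \<noteq> 0"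
      using pos by (simp add: less_imp_neq[symmetric])
  qed
  have "(\<lambda>k. infdist (y + t k *\<^sub>R h + ((t k)\<^sup>2 / 2) *\<^sub>R w) S) \<in> O(\<lambda>k. t k ^ 4)"
    using ev by (intro bigoI[of _ K]) (auto elim!: eventually_mono simp: infdist_nonneg)
  then have o2: "(\<lambda>k. infdist (y + t k *\<^sub>R h + ((t k)\<^sup>2 / 2) *\<^sub>R w) S) \<in> o(\<lambda>k. (t k)\<^sup>2)"
    using small[of 2 4] by (rule landau_o.big_small_trans) simp
  with pos lim show "w \<in> outer_second_order_tangent_set S y h"
    unfolding outer_second_order_tangent_set_def by blast
  have "(\<lambda>k. infdist (y + t k *\<^sub>R h + ((t k)\<^sup>2 / 2) *\<^sub>R w) S + norm w * (t k)\<^sup>2) \<in> o(\<lambda>k. t k ^ 1)"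
    using landau_o.small_trans[OF o2 small[of 1 2]] small[of 1 2]
    by (cases "w = 0") (auto intro: sum_in_smallo)
  moreover have "infdist (y + t k *\<^sub>R h) S
      \<le> infdist (y + t k *\<^sub>R h + ((t k)\<^sup>2 / 2) *\<^sub>R w) S + norm w * (t k)\<^sup>2" for k
  proof -
    have "infdist (y + t k *\<^sub>R h) S \<le> infdist (y + t k *\<^sub>R h + ((t k)\<^sup>2 / 2) *\<^sub>R w) S
        + dist (y + t k *\<^sub>R h) (y + t k *\<^sub>R h + ((t k)\<^sup>2 / 2) *\<^sub>R w)"
      by (rule infdist_triangle)
    also have "dist (y + t k *\<^sub>R h) (y + t k *\<^sub>R h + ((t k)\<^sup>2 / 2) *\<^sub>R w) = norm w * (t k)\<^sup>2 / 2"
      by (simp add: dist_norm)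
    also have "\<dots> \<le> norm w * (t k)\<^sup>2"
      by simp
    finally show ?thesis
      by simp
  qed
  then have "(\<lambda>k. infdist (y + t k *\<^sub>R h) S)
      \<in> O(\<lambda>k. infdist (y + t k *\<^sub>R h + ((t k)\<^sup>2 / 2) *\<^sub>R w) S + norm w * (t k)\<^sup>2)"
    by (intro bigoI[of _ 1] always_eventually allI) (simp add: infdist_nonneg)
  ultimately have "(\<lambda>k. infdist (y + t k *\<^sub>R h) S) \<in> o(t)"
    by (simp add: landau_o.big_small_trans)
  with pos lim show "h \<in> contingent_cone S y"
    unfolding contingent_cone_def by blast
qed

section \<open>From second-order stationarity to the multiplier\<close>

theorem proposition4:
  fixes \<phi> :: "real^'n \<Rightarrow> real" and A :: "real^'n^'m" and b :: "real^'m" and y :: "real^'n"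
  assumes "continuously_differentiable \<phi>"
    and "rank A = CARD('m)"
    and "{x. 0 \<le> x \<and> A *v x = b} \<noteq> {}"
    and "y \<in> hadamard_variety A b"
    and "second_order_stationary (\<lambda>y. \<phi> (y * y)) (hadamard_variety A b) y"
  shows "first_order_stationary \<phi> A b (y * y)"
proof -
  let ?f = "\<lambda>y. \<phi> (y * y)" and ?S = "hadamard_variety A b"
  define g where "g = gradient \<phi> (y * y)"
  have diff: "\<phi> differentiable (at (y * y))"
    using assms(1) by (simp add: continuously_differentiable_def)
  have grad: "gradient ?f y = 2 *\<^sub>R (y * g)"
    unfolding g_def
    by (intro gradient_eqI GDERIV_hadamard_square differentiable_GDERIV_gradient diff)
  obtain H where H: "has_hessian ?f H y"
    and second_order: "\<And>h w. h \<in> contingent_cone ?S y \<Longrightarrow> gradient ?f y \<bullet> h = 0 \<Longrightarrow>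
      w \<in> outer_second_order_tangent_set ?S y h \<Longrightarrow> 0 \<le> gradient ?f y \<bullet> w + h \<bullet> (H *v h)"
    using assms(5) unfolding second_order_stationary_def by blast
  \<comment> \<open>This is the hypothesis of \<open>farkas_coordinates\<close> with
    \<open>J\<close> the zero set of \<open>y\<close>.\<close>
  have "0 \<le> g \<bullet> d" if d: "A *v d = 0" "\<forall>i\<in>{i. y $ i = 0}. 0 \<le> d $ i" for d
  proof -
    define h where "h = (\<chi> i. if y $ i = 0 then sqrt (d $ i) else 0)"
    define w where "w = (\<chi> i. d $ i / y $ i)"
    obtain K where "\<forall>\<^sub>F t in nhds 0. infdist (y + t *\<^sub>R h + (t\<^sup>2 / 2) *\<^sub>R w) ?S \<le> K * t ^ 4"
      using hadamard_variety_arc[OF assms(4) d(1)] d(2) unfolding h_def w_def by blast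
    note tangents = arc_tangents[OF this]
    \<comment> \<open>\<open>gradient ?f y\<close> is a multiple of \<open>y * g\<close>, and
      \<open>h\<close> vanishes wherever \<open>y\<close> does not.\<close>
    have "gradient ?f y \<bullet> h = 0"
      unfolding grad inner_vec_def h_def by (intro sum.neutral) simp
    with tangents have "0 \<le> gradient ?f y \<bullet> w + h \<bullet> (H *v h)"
      using second_order by blast
    \<comment> \<open>Only rows of \<open>H\<close> off the support of \<open>y\<close> enter, and
      these are diagonal; the two factors \<open>sqrt (d $ i)\<close> multiply to
      \<open>d $ i\<close>.\<close>
    also have "h \<bullet> (H *v h) = (\<Sum>i\<in>UNIV. if y $ i = 0 then 2 * (g $ i * d $ i) else 0)"
      unfolding inner_vec_def
    proof (rule sum.cong)
      fix i
      show "h $ i \<bullet> (H *v h) $ i = (if y $ i = 0 then 2 * (g $ i * d $ i) else 0)"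
      proof (cases "y $ i = 0")
        case True
        have "(H *v h) $ i = (\<Sum>j\<in>UNIV. H $ i $ j * h $ j)"
          by (simp add: matrix_vector_mult_def)
        also have "\<dots> = (\<Sum>j\<in>UNIV. if i = j then 2 * g $ i * h $ i else 0)"
          by (intro sum.cong) (auto simp: hessian_hadamard_square_off_support[OF assms(1) H True] g_def)
        also have "\<dots> = 2 * g $ i * h $ i"
          by simp
        finally have "(H *v h) $ i = 2 * g $ i * h $ i" .
        then have "h $ i \<bullet> (H *v h) $ i = 2 * (g $ i * (sqrt (d $ i))\<^sup>2)"
          using True by (simp add: h_def power2_eq_square)
        with True d(2) show ?thesis
          by simp
      qed (simp add: h_def)
    qed simp
    \<comment> \<open>On the support the factor \<open>y $ i\<close> cancels the denominator of
      \<open>w $ i\<close>, supplying exactly the indices absent from the Hessian term.\<close>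
    also have "gradient ?f y \<bullet> w = (\<Sum>i\<in>UNIV. if y $ i = 0 then 0 else 2 * (g $ i * d $ i))"
      unfolding grad inner_vec_def w_def by (intro sum.cong) auto
    also have "\<dots> + (\<Sum>i\<in>UNIV. if y $ i = 0 then 2 * (g $ i * d $ i) else 0) = 2 * (g \<bullet> d)"
      unfolding inner_vec_def sum.distrib[symmetric] sum_distrib_left by (intro sum.cong) auto
    finally show ?thesis
      by simp
  qed
  then obtain lam where
    "\<forall>i\<in>{i. y $ i = 0}. 0 \<le> (g - transpose A *v lam) $ i"
    "\<forall>i. i \<notin> {i. y $ i = 0} \<longrightarrow> (g - transpose A *v lam) $ i = 0"
    using farkas_coordinates by blast
  \<comment> \<open>On the support of \<open>y\<close> the residual is zero, elsewhere nonnegative;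
    this yields both dual feasibility and complementarity with \<open>y * y\<close>.\<close>
  then have "0 \<le> (g - transpose A *v lam) $ i" "y $ i = 0 \<or> (g - transpose A *v lam) $ i = 0" for i
    by (cases "y $ i = 0"; simp)+
  then have "0 \<le> g - transpose A *v lam" "(g - transpose A *v lam) * (y * y) = 0"
    by (auto simp: less_eq_vec_def vec_eq_iff)
  moreover have "A *v (y * y) = b" "0 \<le> y * y"
    using assms(4) by (auto simp: hadamard_variety_def less_eq_vec_def)
  ultimately show ?thesis
    using diff unfolding first_order_stationary_def g_def by blast
qed

end
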